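(* For every coloring game on $n$ players (with arbitrary weights in $\mathbb{Z}\cup\{-\infty\}$), if only $1$-deviations are allowed, the dynamics always converges (to a $1$-stable partition) in $O(w_p n^2)$ steps, where $w_p$ denotes the largest positive weight of the game if there is one, and $0$ otherwise.
   Context: A coloring game is given by a finite set $V$ of $n$ players and a symmetric weight function $w$ with $w_{uv}=w_{vu}\in \mathbb{Z}\cup\{-\infty\}$ for distinct $u,v$ (pairs with weight $-\infty$ are enemies). A state is a partition $P$ of $V$; $X(u)$ is the group of $u$ and $f_u(P)=\sum_{v\in X(u)\setminus\{u\}} w_{uv}$. A $k$-deviation from $P$ is a set $S$ of at most $k$ players and a (possibly empty) group $X$ of $P$ such that moving all players of $S$ into $X$ strictly increases the utility of every member of $S$. A partition is $k$-stable if no $k$-deviation exists. The dynamics starts from the all-singletons partition and applies an arbitrary $k$-deviation as long as one exists. *)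

theory Defs
  imports Complex_Main "HOL-Library.Extended" "HOL-Library.Disjoint_Sets"
begin

text \<open>Weights live in \<^typ>\<open>int extended\<close> with the value \<^const>\<open>Pinf\<close> excluded on the relevant pairs;
  values of \<open>w\<close> on the diagonal and outside \<open>V\<close> are irrelevant.\<close>

definition coloring_game :: "'a set \<Rightarrow> ('a \<Rightarrow> 'a \<Rightarrow> int extended) \<Rightarrow> bool" where
  "coloring_game V w \<longleftrightarrow> finite V \<and>
     (\<forall>u\<in>V. \<forall>v\<in>V. u \<noteq> v \<longrightarrow> w u v = w v u \<and> w u v \<noteq> Pinf)"

definition group_of :: "'a set set \<Rightarrow> 'a \<Rightarrow> 'a set" where
  "group_of P u = (THE X. X \<in> P \<and> u \<in> X)"

definition utility :: "('a \<Rightarrow> 'a \<Rightarrow> int extended) \<Rightarrow> 'a set set \<Rightarrow> 'a \<Rightarrow> int extended" where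
  "utility w P u = (\<Sum>v\<in>group_of P u - {u}. w u v)"

text \<open>The empty group is not a member of a partition: \<open>X = {}\<close> makes \<open>S\<close> a new group, and
  groups left empty by the move disappear.\<close>

definition move :: "'a set \<Rightarrow> 'a set \<Rightarrow> 'a set set \<Rightarrow> 'a set set" where
  "move S X P = insert (X \<union> S) ((\<lambda>Y. Y - S) ` (P - {X})) - {{}}"

text \<open>The set \<open>S\<close> of deviating players has to be nonempty, since otherwise the condition on the
  utilities would hold vacuously in every state.\<close>

definition k_deviation ::
  "'a set \<Rightarrow> ('a \<Rightarrow> 'a \<Rightarrow> int extended) \<Rightarrow> nat \<Rightarrow> 'a set set \<Rightarrow> 'a set \<Rightarrow> 'a set \<Rightarrow> bool" where
  "k_deviation V w k P S X \<longleftrightarrow>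
     S \<subseteq> V \<and> S \<noteq> {} \<and> card S \<le> k \<and> (X \<in> P \<or> X = {}) \<and>
     (\<forall>u\<in>S. utility w P u < utility w (move S X P) u)"

definition k_stable :: "'a set \<Rightarrow> ('a \<Rightarrow> 'a \<Rightarrow> int extended) \<Rightarrow> nat \<Rightarrow> 'a set set \<Rightarrow> bool" where
  "k_stable V w k P \<longleftrightarrow> partition_on V P \<and> \<not> (\<exists>S X. k_deviation V w k P S X)"

definition deviation_step ::
  "'a set \<Rightarrow> ('a \<Rightarrow> 'a \<Rightarrow> int extended) \<Rightarrow> nat \<Rightarrow> 'a set set \<Rightarrow> 'a set set \<Rightarrow> bool" where
  "deviation_step V w k P Q \<longleftrightarrow> (\<exists>S X. k_deviation V w k P S X \<and> Q = move S X P)"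

text \<open>A run of the dynamics. Runs that stop are represented as infinite sequences that stay
  constant from the first state without a deviation on.\<close>

definition dynamics ::
  "'a set \<Rightarrow> ('a \<Rightarrow> 'a \<Rightarrow> int extended) \<Rightarrow> nat \<Rightarrow> (nat \<Rightarrow> 'a set set) \<Rightarrow> bool" where
  "dynamics V w k \<sigma> \<longleftrightarrow>
     \<sigma> 0 = (\<lambda>v. {v}) ` V \<and>
     (\<forall>i. if \<exists>S X. k_deviation V w k (\<sigma> i) S X
          then deviation_step V w k (\<sigma> i) (\<sigma> (Suc i))
          else \<sigma> (Suc i) = \<sigma> i)"

text \<open>The run performs exactly \<open>t\<close> deviations, the last one leading to a \<open>k\<close>-stable partition.\<close>

definition converges_in ::
  "'a set \<Rightarrow> ('a \<Rightarrow> 'a \<Rightarrow> int extended) \<Rightarrow> nat \<Rightarrow> (nat \<Rightarrow> 'a set set) \<Rightarrow> nat \<Rightarrow> bool" where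
  "converges_in V w k \<sigma> t \<longleftrightarrow>
     (\<forall>i<t. deviation_step V w k (\<sigma> i) (\<sigma> (Suc i))) \<and> k_stable V w k (\<sigma> t)"

definition largest_positive_weight :: "'a set \<Rightarrow> ('a \<Rightarrow> 'a \<Rightarrow> int extended) \<Rightarrow> int" where
  "largest_positive_weight V w =
     (let A = {c. 0 < c \<and> (\<exists>u\<in>V. \<exists>v\<in>V. u \<noteq> v \<and> w u v = Fin c)}
      in if A = {} then 0 else Max A)"

end

theory Submission
  imports Defs
begin

text \<open>The sum of all utilities is a potential: it starts at 0, a deviation of a single player
  raises it by twice the gain of that player because the weights are symmetric, and it never
  exceeds \<open>w\<^sub>p n\<^sup>2\<close>. Infinite utilities never occur, because a player who strictly gains
  does not join an enemy, so every run stays among partitions without enemies in a group.\<close>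

section \<open>Groups of a partition and their behaviour under a move\<close>

lemma group_of_eq:
  assumes "partition_on V P" "Y \<in> P" "x \<in> Y"
  shows "group_of P x = Y"
  unfolding group_of_def
proof (rule the_equality)
  fix Z assume "Z \<in> P \<and> x \<in> Z"
  then show "Z = Y"
    using disjointD[OF partition_onD2[OF assms(1)], of Z Y] assms(2,3) by auto
qed (use assms in simp)

lemma group_of_mem:
  assumes "partition_on V P" "x \<in> V"
  shows "group_of P x \<in> P" "x \<in> group_of P x"
proof -
  obtain Y where "Y \<in> P" "x \<in> Y"
    using assms by (auto simp: partition_on_def)
  with group_of_eq[OF assms(1)] show "group_of P x \<in> P" "x \<in> group_of P x"
    by auto
qed

lemma group_of_subset:
  assumes "partition_on V P" "x \<in> V"
  shows "group_of P x \<subseteq> V"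
  using group_of_mem(1)[OF assms] partition_onD1[OF assms(1)] by blast

lemma group_of_sym:
  assumes "partition_on V P" "x \<in> V" "y \<in> V"
  shows "y \<in> group_of P x \<longleftrightarrow> x \<in> group_of P y"
  using group_of_eq[OF assms(1)] group_of_mem[OF assms(1)] assms(2,3) by metis

lemma partition_on_move:
  assumes P: "partition_on V P" and S: "S \<subseteq> V" and X: "X \<in> P \<or> X = {}"
  shows "partition_on V (move S X P)"
proof (rule partition_onI)
  have un: "\<Union>P = V" using P by (simp add: partition_on_def)
  show "\<Union>(move S X P) = V"
  proof
    show "\<Union>(move S X P) \<subseteq> V"
      using un S X by (auto simp: move_def)
    show "V \<subseteq> \<Union>(move S X P)"
    proof
      fix x assume "x \<in> V"
      then obtain Y where "Y \<in> P" "x \<in> Y" using un by auto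
      then have "x \<in> X \<union> S \<or> (x \<in> Y - S \<and> Y \<in> P - {X})" by blast
      then show "x \<in> \<Union>(move S X P)"
        unfolding move_def by blast
    qed
  qed
next
  fix A B assume "A \<in> move S X P" "B \<in> move S X P" "A \<noteq> B"
  \<comment> \<open>Each member of the new family is determined by any one of its elements, so two
    distinct members cannot share an element.\<close>
  moreover have "D = (if x \<in> X \<union> S then X \<union> S else group_of P x - S)"
    if D: "D \<in> move S X P" "x \<in> D" for D x
  proof (cases "D = X \<union> S")
    case False
    then obtain Y where Y: "Y \<in> P" "Y \<noteq> X" "D = Y - S"
      using D(1) by (auto simp: move_def)
    then have "group_of P x = Y"
      using D(2) group_of_eq[OF P] by simp
    moreover have "x \<notin> X"
      using calculation Y(2) X group_of_eq[OF P, of X x] by auto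
    ultimately show ?thesis using D(2) Y(3) by simp
  qed (use D in simp)
  ultimately show "disjnt A B"
    unfolding disjnt_iff by metis
qed (simp add: move_def)

lemma group_of_move_target:
  assumes "partition_on V P" "S \<subseteq> V" "X \<in> P \<or> X = {}" "x \<in> X \<union> S"
  shows "group_of (move S X P) x = X \<union> S"
  by (rule group_of_eq[OF partition_on_move[OF assms(1-3)]]) (use assms(4) in \<open>auto simp: move_def\<close>)

text \<open>The move only adds players of \<open>S\<close> to \<open>X\<close> and only removes
  players of \<open>S\<close> from other groups, so who is together with whom outside
  \<open>S\<close> stays the same.\<close>

lemma group_of_move_other:
  assumes P: "partition_on V P" and S: "S \<subseteq> V" and X: "X \<in> P \<or> X = {}"
    and x: "x \<in> V" "x \<notin> S" and y: "y \<notin> S"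
  shows "y \<in> group_of (move S X P) x \<longleftrightarrow> y \<in> group_of P x"
proof (cases "x \<in> X")
  case True
  then have "group_of P x = X" using group_of_eq[OF P] X by auto
  then show ?thesis
    using group_of_move_target[OF P S X] True y by simp
next
  case False
  \<comment> \<open>The group of \<open>x\<close> differs from \<open>X\<close>, and what remains of
    it is nonempty because it still contains \<open>x\<close>.\<close>
  then have "group_of P x - S \<in> move S X P"
    using group_of_mem[OF P x(1)] x by (auto simp: move_def)
  then have "group_of (move S X P) x = group_of P x - S"
    using group_of_mem[OF P x(1)] x by (intro group_of_eq[OF partition_on_move[OF P S X]]) auto
  then show ?thesis using y by simp
qed

section \<open>Utilities as integer sums and the potential\<close>

text \<open>The values at \<^const>\<open>Pinf\<close> and \<^const>\<open>Minf\<close> are arbitrary, except that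
  the bound on the potential needs them to be nonpositive.\<close>

primrec fin_part :: "int extended \<Rightarrow> int" where
  "fin_part (Fin c) = c"
| "fin_part Pinf = 0"
| "fin_part Minf = 0"

text \<open>Without \<open>Pinf\<close>, the value \<open>Minf\<close> is absorbing for
  addition.\<close>

lemma sum_extended_not_Pinf:
  assumes "finite A" "\<And>v. v \<in> A \<Longrightarrow> f v \<noteq> Pinf"
  shows "sum f A = (if Minf \<in> f ` A then Minf else Fin (\<Sum>v\<in>A. fin_part (f v)))"
  using assms
proof (induction A rule: finite_induct)
  case empty
  then show ?case by (simp add: zero_extended_def)
next
  case (insert a A)
  then show ?case by (cases "f a") auto
qed

text \<open>Padding with 0 outside the group lets sums run over index sets that do not depend on
  \<open>P\<close>, so that two partitions can be compared term by term.\<close>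

definition group_weight :: "('a \<Rightarrow> 'a \<Rightarrow> int extended) \<Rightarrow> 'a set set \<Rightarrow> 'a \<Rightarrow> 'a \<Rightarrow> int" where
  "group_weight w P x y = (if y \<in> group_of P x then fin_part (w x y) else 0)"

definition potential :: "'a set \<Rightarrow> ('a \<Rightarrow> 'a \<Rightarrow> int extended) \<Rightarrow> 'a set set \<Rightarrow> int" where
  "potential V w P = (\<Sum>x\<in>V. \<Sum>y\<in>V - {x}. group_weight w P x y)"

definition enemy_free :: "'a set \<Rightarrow> ('a \<Rightarrow> 'a \<Rightarrow> int extended) \<Rightarrow> 'a set set \<Rightarrow> bool" where
  "enemy_free V w P \<longleftrightarrow> (\<forall>x\<in>V. \<forall>y\<in>group_of P x - {x}. w x y \<noteq> Minf)"

lemma utility_eq: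
  assumes G: "coloring_game V w" and P: "partition_on V P" and u: "u \<in> V"
  shows "utility w P u = (if Minf \<in> w u ` (group_of P u - {u}) then Minf
           else Fin (\<Sum>y\<in>V - {u}. group_weight w P u y))"
proof -
  have sub: "group_of P u \<subseteq> V" by (rule group_of_subset[OF P u])
  have fin: "finite V" using G by (simp add: coloring_game_def)
  have "(\<Sum>y\<in>V - {u}. group_weight w P u y) = (\<Sum>y\<in>group_of P u - {u}. fin_part (w u y))"
    by (rule sum.mono_neutral_cong_right) (use sub fin in \<open>auto simp: group_weight_def\<close>)
  moreover have "utility w P u = (if Minf \<in> w u ` (group_of P u - {u}) then Minf
           else Fin (\<Sum>y\<in>group_of P u - {u}. fin_part (w u y)))"
    unfolding utility_def
    by (rule sum_extended_not_Pinf) (use G sub fin u in \<open>auto simp: coloring_game_def intro: finite_subset\<close>)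
  ultimately show ?thesis by simp
qed

lemma group_weight_sym:
  assumes "coloring_game V w" "partition_on V P" "x \<in> V" "y \<in> V" "x \<noteq> y"
  shows "group_weight w P x y = group_weight w P y x"
proof -
  have "w x y = w y x" using assms by (simp add: coloring_game_def)
  then show ?thesis by (simp add: group_weight_def group_of_sym[OF assms(2-4)])
qed

text \<open>Symmetry collects all pairs containing \<open>u\<close> into twice one row; the
  remainder only sees pairs avoiding \<open>u\<close>, which a move of \<open>u\<close> alone cannot
  affect.\<close>

lemma potential_split:
  assumes G: "coloring_game V w" and P: "partition_on V P" and u: "u \<in> V"
  shows "potential V w P = 2 * (\<Sum>y\<in>V - {u}. group_weight w P u y)
           + (\<Sum>x\<in>V - {u}. \<Sum>y\<in>V - {u} - {x}. group_weight w P x y)"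
proof -
  have fin: "finite V" using G by (simp add: coloring_game_def)
  have "(\<Sum>y\<in>V - {x}. group_weight w P x y)
      = group_weight w P u x + (\<Sum>y\<in>V - {u} - {x}. group_weight w P x y)"
    if x: "x \<in> V - {u}" for x
  proof -
    have "(\<Sum>y\<in>V - {x}. group_weight w P x y)
        = group_weight w P x u + (\<Sum>y\<in>V - {x} - {u}. group_weight w P x y)"
      by (rule sum.remove) (use fin u x in auto)
    moreover have "V - {x} - {u} = V - {u} - {x}" by blast
    moreover have "group_weight w P x u = group_weight w P u x"
      using group_weight_sym[OF G P, of x u] u x by simp
    ultimately show ?thesis by simp
  qed
  then have "(\<Sum>x\<in>V - {u}. \<Sum>y\<in>V - {x}. group_weight w P x y)
      = (\<Sum>x\<in>V - {u}. group_weight w P u x)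
        + (\<Sum>x\<in>V - {u}. \<Sum>y\<in>V - {u} - {x}. group_weight w P x y)"
    unfolding sum.distrib[symmetric] by (rule sum.cong[OF refl])
  then show ?thesis
    unfolding potential_def sum.remove[OF fin u] by linarith
qed

section \<open>Growth of the potential in a single deviation\<close>

text \<open>The gain of the deviating player is a positive integer, hence at least 1, and it enters
  the potential twice.\<close>

lemma deviation_step_1:
  assumes G: "coloring_game V w" and P: "partition_on V P" and ef: "enemy_free V w P"
    and step: "deviation_step V w 1 P Q"
  shows "partition_on V Q" "enemy_free V w Q" "potential V w P + 2 \<le> potential V w Q"
proof -
  obtain S X where S: "S \<subseteq> V" "S \<noteq> {}" "card S \<le> 1" and X: "X \<in> P \<or> X = {}"
    and gain: "\<forall>u\<in>S. utility w P u < utility w Q u" and Q: "Q = move S X P"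
    using step by (auto simp: deviation_step_def k_deviation_def)
  have "finite S" using S(1) G by (auto simp: coloring_game_def intro: finite_subset)
  then have "card S = 1" using S(2,3) by (metis card_0_eq le_antisym less_one not_le)
  then obtain u where u: "S = {u}" by (rule card_1_singletonE)
  have uV: "u \<in> V" using S(1) u by simp
  show Q_part: "partition_on V Q"
    unfolding Q by (rule partition_on_move[OF P S(1) X])
  have other: "y \<in> group_of Q x \<longleftrightarrow> y \<in> group_of P x" if "x \<in> V" "x \<noteq> u" "y \<noteq> u" for x y
    using group_of_move_other[OF P S(1) X] that u Q by simp
  have not_Minf: "Minf \<notin> w u ` (group_of P u - {u})"
    using ef uV unfolding enemy_free_def image_iff by metis
  have less: "utility w P u < utility w Q u" using gain u by simp
  \<comment> \<open>The new utility lies strictly above another value, so it is not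
    \<open>Minf\<close>: the player has joined no enemy.\<close>
  then have not_Minf': "Minf \<notin> w u ` (group_of Q u - {u})"
    unfolding utility_eq[OF G P uV] utility_eq[OF G Q_part uV] using not_Minf
    by (auto split: if_splits)
  have gain_u: "(\<Sum>y\<in>V - {u}. group_weight w P u y) < (\<Sum>y\<in>V - {u}. group_weight w Q u y)"
    using less not_Minf not_Minf'
    unfolding utility_eq[OF G P uV] utility_eq[OF G Q_part uV] by simp
  show "enemy_free V w Q"
    unfolding enemy_free_def
  proof (intro ballI)
    fix x y assume x: "x \<in> V" and y: "y \<in> group_of Q x - {x}"
    have yV: "y \<in> V" using y group_of_subset[OF Q_part x] by auto
    \<comment> \<open>Pairs containing \<open>u\<close> reduce to \<open>not_Minf'\<close>, by
      symmetry if necessary; all other pairs were already together in \<open>P\<close>.\<close>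
    consider "x = u" | "x \<noteq> u" "y = u" | "x \<noteq> u" "y \<noteq> u" by blast
    then show "w x y \<noteq> Minf"
    proof cases
      case 1
      then show ?thesis using not_Minf' y by (metis image_eqI)
    next
      case 2
      then have "x \<in> group_of Q u - {u}"
        using y group_of_sym[OF Q_part x yV] by simp
      moreover have "w x y = w u x"
        using G x uV 2 by (auto simp: coloring_game_def)
      ultimately show ?thesis using not_Minf' by (metis image_eqI)
    next
      case 3
      then show ?thesis using other[OF x] y ef x by (auto simp: enemy_free_def)
    qed
  qed
  have "(\<Sum>x\<in>V - {u}. \<Sum>y\<in>V - {u} - {x}. group_weight w P x y)
      = (\<Sum>x\<in>V - {u}. \<Sum>y\<in>V - {u} - {x}. group_weight w Q x y)"
    by (intro sum.cong refl) (auto simp: group_weight_def other)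
  then show "potential V w P + 2 \<le> potential V w Q"
    unfolding potential_split[OF G P uV] potential_split[OF G Q_part uV] using gain_u by linarith
qed

section \<open>Upper bound on the potential\<close>

lemma fin_part_le_largest_positive_weight:
  assumes V: "finite V"
  shows "0 \<le> largest_positive_weight V w"
    and "\<And>u v. u \<in> V \<Longrightarrow> v \<in> V \<Longrightarrow> u \<noteq> v \<Longrightarrow> fin_part (w u v) \<le> largest_positive_weight V w"
proof -
  define A where "A = {c. 0 < c \<and> (\<exists>u\<in>V. \<exists>v\<in>V. u \<noteq> v \<and> w u v = Fin c)}"
  have L: "largest_positive_weight V w = (if A = {} then 0 else Max A)"
    unfolding largest_positive_weight_def A_def Let_def by (rule refl)
  \<comment> \<open>\<open>Max\<close> is meaningful only for a finite set; there are at most as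
    many weights as pairs of players.\<close>
  have "A \<subseteq> (\<lambda>(u, v). fin_part (w u v)) ` (V \<times> V)"
  proof
    fix c assume "c \<in> A"
    then obtain u v where "u \<in> V" "v \<in> V" "w u v = Fin c"
      by (auto simp: A_def)
    then show "c \<in> (\<lambda>(u, v). fin_part (w u v)) ` (V \<times> V)"
      by (intro image_eqI[of _ _ "(u, v)"]) auto
  qed
  then have fin: "finite A"
    using V by (auto intro: finite_subset)
  have "0 < Max A" if "A \<noteq> {}"
    using Max_in[OF fin that] by (simp add: A_def)
  then show nonneg: "0 \<le> largest_positive_weight V w"
    by (simp add: L less_imp_le)
  fix u v assume uv: "u \<in> V" "v \<in> V" "u \<noteq> v"
  show "fin_part (w u v) \<le> largest_positive_weight V w"
  \<comment> \<open>A positive finite part is a genuine weight in \<open>A\<close>; everything else,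
    including the value 0 given to \<open>Minf\<close>, is covered by nonnegativity.\<close>
  proof (cases "0 < fin_part (w u v)")
    case True
    then have "fin_part (w u v) \<in> A"
      using uv by (cases "w u v") (auto simp: A_def)
    then show ?thesis using Max_ge[OF fin] by (auto simp: L)
  next
    case False
    then show ?thesis using nonneg by simp
  qed
qed

lemma potential_le:
  assumes V: "finite V"
  shows "potential V w P \<le> largest_positive_weight V w * (int (card V))\<^sup>2"
proof -
  let ?L = "largest_positive_weight V w"
  note L = fin_part_le_largest_positive_weight[OF V, where w = w]
  have "(\<Sum>y\<in>V - {x}. group_weight w P x y) \<le> int (card V) * ?L" if "x \<in> V" for x
  proof -
    have "(\<Sum>y\<in>V - {x}. group_weight w P x y) \<le> int (card (V - {x})) * ?L"
      by (rule sum_bounded_above) (use L that in \<open>auto simp: group_weight_def\<close>)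
    \<comment> \<open>Enlarging the factor is sound because \<open>?L\<close> is
      nonnegative.\<close>
    also have "\<dots> \<le> int (card V) * ?L"
      using L(1) V by (intro mult_right_mono) (auto intro: card_mono)
    finally show ?thesis .
  qed
  then have "potential V w P \<le> int (card V) * (int (card V) * ?L)"
    unfolding potential_def by (intro sum_bounded_above)
  then show ?thesis by (simp add: power2_eq_square mult_ac)
qed

section \<open>Runs of the dynamics\<close>

lemma singletons_initial:
  fixes V :: "'a set"
  defines "P \<equiv> (\<lambda>v. {v}) ` V"
  shows "enemy_free V w P" "potential V w P = 0"
proof -
  have "group_of P x = {x}" if "x \<in> V" for x
    unfolding P_def by (rule group_of_eq[OF partition_on_singletons]) (use that in auto)
  then show "enemy_free V w P" "potential V w P = 0"
    by (auto simp: enemy_free_def potential_def group_weight_def intro!: sum.neutral)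
qed

text \<open>Instability is assumed at all earlier times because a run that has stopped stays
  constant and its potential no longer grows.\<close>

lemma dynamics_1_invariant:
  assumes G: "coloring_game V w" and D: "dynamics V w 1 \<sigma>"
    and unstable: "\<And>i. i < t \<Longrightarrow> \<exists>S X. k_deviation V w 1 (\<sigma> i) S X"
  shows "partition_on V (\<sigma> t) \<and> enemy_free V w (\<sigma> t) \<and> 2 * int t \<le> potential V w (\<sigma> t)"
  using unstable
proof (induction t)
  case 0
  then show ?case
    using D singletons_initial[where V = V and w = w] partition_on_singletons[of V]
    by (simp add: dynamics_def)
next
  case (Suc t)
  then have IH: "partition_on V (\<sigma> t)" "enemy_free V w (\<sigma> t)" "2 * int t \<le> potential V w (\<sigma> t)"
    by simp_all
  have "deviation_step V w 1 (\<sigma> t) (\<sigma> (Suc t))"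
    using D Suc.prems[of t] by (auto simp: dynamics_def)
  from deviation_step_1[OF G IH(1,2) this] IH(3) show ?case by simp
qed

theorem theorem5:
  shows "\<exists>C::real. \<forall>(V::'a set) (w::'a \<Rightarrow> 'a \<Rightarrow> int extended) (\<sigma>::nat \<Rightarrow> 'a set set).
    coloring_game V w \<longrightarrow> dynamics V w 1 \<sigma> \<longrightarrow>
      (\<exists>t. converges_in V w 1 \<sigma> t \<and>
           real t \<le> C * real_of_int (largest_positive_weight V w) * (real (card V))\<^sup>2)"
\<comment> \<open>The factor 1/2 arises because the potential, bounded by \<open>?B\<close>, grows
  by at least 2 per deviation.\<close>
proof (intro exI[of _ "1/2"] allI impI)
  fix V :: "'a set" and w :: "'a \<Rightarrow> 'a \<Rightarrow> int extended" and \<sigma> :: "nat \<Rightarrow> 'a set set"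
  assume G: "coloring_game V w" and D: "dynamics V w 1 \<sigma>"
  let ?B = "largest_positive_weight V w * (int (card V))\<^sup>2"
  let ?unstable = "\<lambda>i. \<exists>S X. k_deviation V w 1 (\<sigma> i) S X"
  have "finite V" using G by (simp add: coloring_game_def)
  then have bound: "2 * int t \<le> ?B" if "\<And>i. i < t \<Longrightarrow> ?unstable i" for t
    using dynamics_1_invariant[OF G D, of t] that potential_le[of V w "\<sigma> t"] by fastforce
  have "\<exists>t. \<not> ?unstable t"
  proof (rule ccontr)
    assume "\<not> ?thesis"
    \<comment> \<open>If no state were stable, \<open>bound\<close> would hold at every time. The
      time \<open>nat ?B + 1\<close> refutes it whatever the sign of \<open>?B\<close>, since
      \<open>nat\<close> sends negative numbers to 0.\<close>
    then have "2 * int (nat ?B + 1) \<le> ?B" by (intro bound) blast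
    moreover have "b < 2 * int (nat b + 1)" for b :: int by (cases "0 \<le> b") auto
    ultimately show False using not_le by blast
  qed
  \<comment> \<open>Minimality makes every step before \<open>t\<close> a real deviation rather than
    constant padding.\<close>
  define t where "t = (LEAST t. \<not> ?unstable t)"
  have t: "\<not> ?unstable t"
    unfolding t_def by (rule LeastI_ex) fact
  have before: "?unstable i" if "i < t" for i
    using not_less_Least[OF that[unfolded t_def]] by (rule notnotD)
  have "deviation_step V w 1 (\<sigma> i) (\<sigma> (Suc i))" if "i < t" for i
    using D before[OF that] by (auto simp: dynamics_def)
  moreover have "k_stable V w 1 (\<sigma> t)"
    using t dynamics_1_invariant[OF G D before] by (simp add: k_stable_def)
  moreover have "real_of_int (2 * int t) \<le> real_of_int ?B"
    using bound[OF before] by (simp only: of_int_le_iff)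
  ultimately show "\<exists>t. converges_in V w 1 \<sigma> t \<and>
      real t \<le> 1/2 * real_of_int (largest_positive_weight V w) * (real (card V))\<^sup>2"
    by (intro exI[of _ t]) (simp add: converges_in_def)
qed

end
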